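(* Let $K$ be an infinite field, $n\ge 2$ and $S=K[x_1,\ldots,x_n]$. Let $r\ge 1$, let $1\leq i_1<i_2<\cdots<i_r\leq n$ be integers, let $\alpha_1,\ldots,\alpha_r$ be positive integers, and let $u=x_{i_1}^{\alpha_1}x_{i_2}^{\alpha_2}\cdots x_{i_r}^{\alpha_r}\in S$. Then the principal (SBT)-ideal generated by $u$ is $$SBT(u)=\prod_{q=1}^{r}\bigl(x_1^{\alpha_q},x_2^{\alpha_q},\ldots,x_{i_q}^{\alpha_q}\bigr),$$ the product of the ideals of $S$ generated by the $\alpha_q$-th powers of $x_1,\ldots,x_{i_q}$.
   Context: For a monomial $v\in S$, $\nu_i(v)$ denotes the exponent of $x_i$ in $v$. A monomial ideal $I\subset S$ is of strong Borel type (SBT) if for every monomial $v\in I$ and all $1\leq j<i\leq n$ there exists an integer $0\leq t\leq \nu_i(v)$ such that $x_j^{t}v/x_i^{\nu_i(v)}\in I$. For a monomial $u\in S$, the principal (SBT)-ideal generated by $u$, denoted $SBT(u)$, is the smallest (with respect to inclusion) ideal of strong Borel type containing $u$. *)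

theory Defs
  imports "HOL-Algebra.Ideal_Product" "HOL-Library.Poly_Mapping"
begin

text \<open>
  An exponent vector is a finitely supported map \<open>nat \<Rightarrow>\<^sub>0 nat\<close>, and
  \<open>(nat \<Rightarrow>\<^sub>0 nat) \<Rightarrow>\<^sub>0 'k\<close>, with its convolution product, is the polynomial ring over \<open>'k\<close>
  in the variables \<open>x\<^sub>0, x\<^sub>1, \<dots>\<close>.  The ring \<open>K[x\<^sub>1, \<dots>, x\<^sub>n]\<close> is the subring of those
  polynomials in which only \<open>x\<^sub>1, \<dots>, x\<^sub>n\<close> occur.
\<close>

type_synonym 'k mpoly = "(nat \<Rightarrow>\<^sub>0 nat) \<Rightarrow>\<^sub>0 'k"

definition poly_ring :: "nat \<Rightarrow> 'k::field mpoly ring" where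
  "poly_ring n =
     \<lparr> carrier = {f. \<forall>m \<in> Poly_Mapping.keys f. Poly_Mapping.keys m \<subseteq> {1..n}},
       mult = (*), one = 1, zero = 0, add = (+) \<rparr>"

definition monom :: "(nat \<Rightarrow>\<^sub>0 nat) \<Rightarrow> 'k::field mpoly" where
  "monom m = Poly_Mapping.single m 1"

definition var :: "nat \<Rightarrow> 'k::field mpoly" where
  "var i = monom (Poly_Mapping.single i 1)"

definition monomials :: "nat \<Rightarrow> 'k::field mpoly set" where
  "monomials n = {monom m | m. Poly_Mapping.keys m \<subseteq> {1..n}}"

definition monomial_ideal :: "nat \<Rightarrow> 'k::field mpoly set \<Rightarrow> bool" where
  "monomial_ideal n I \<longleftrightarrow> (\<exists>M \<subseteq> monomials n. I = genideal (poly_ring n) M)"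

text \<open>
  For \<open>v = monom m\<close> the exponent \<open>\<nu>\<^sub>i(v)\<close> is \<open>lookup m i\<close>; subtracting \<open>single i (lookup m i)\<close>
  from \<open>m\<close> is the exact division of \<open>v\<close> by \<open>x\<^sub>i\<close> to the power \<open>\<nu>\<^sub>i(v)\<close>.
\<close>

definition strong_Borel_type :: "nat \<Rightarrow> 'k::field mpoly set \<Rightarrow> bool" where
  "strong_Borel_type n I \<longleftrightarrow> monomial_ideal n I \<and>
     (\<forall>m. monom m \<in> I \<longrightarrow> (\<forall>i j. 1 \<le> j \<and> j < i \<and> i \<le> n \<longrightarrow>
        (\<exists>t \<le> Poly_Mapping.lookup m i.
           monom (Poly_Mapping.single j t
                  + (m - Poly_Mapping.single i (Poly_Mapping.lookup m i))) \<in> I)))"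

text \<open>
  The order on sets is inclusion.  The least element exists whenever \<open>u\<close> is a monomial of
  \<open>K[x\<^sub>1, \<dots>, x\<^sub>n]\<close>; see \<open>SBT_is_least\<close> below.
\<close>

definition SBT :: "nat \<Rightarrow> 'k::field mpoly \<Rightarrow> 'k mpoly set" where
  "SBT n u = (LEAST I. strong_Borel_type n I \<and> u \<in> I)"


lemma poly_ring_sel [simp]:
  "mult (poly_ring n) = (*)" "one (poly_ring n) = 1"
  "zero (poly_ring n) = 0" "add (poly_ring n) = (+)"
  by (simp_all add: poly_ring_def)

lemma carrier_poly_ring:
  "f \<in> carrier (poly_ring n) \<longleftrightarrow> (\<forall>m \<in> Poly_Mapping.keys f. Poly_Mapping.keys m \<subseteq> {1..n})"
  by (simp add: poly_ring_def)

lemma keys_add_nat: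
  "Poly_Mapping.keys (a + b) = Poly_Mapping.keys a \<union> Poly_Mapping.keys (b :: nat \<Rightarrow>\<^sub>0 nat)"
  by (auto simp: in_keys_iff lookup_add)

lemma carrier_add:
  "f \<in> carrier (poly_ring n) \<Longrightarrow> g \<in> carrier (poly_ring n) \<Longrightarrow> f + g \<in> carrier (poly_ring n)"
  using Poly_Mapping.keys_add[of f g] by (auto simp: carrier_poly_ring)

lemma carrier_mult:
  "f \<in> carrier (poly_ring n) \<Longrightarrow> g \<in> carrier (poly_ring n) \<Longrightarrow> f * g \<in> carrier (poly_ring n)"
  unfolding carrier_poly_ring
  using keys_mult[of f g] by (fastforce simp: keys_add_nat)

lemma poly_ring_cring: "cring (poly_ring n :: 'k::field mpoly ring)"
proof (intro cringI abelian_groupI comm_monoidI)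
  fix f :: "'k mpoly" assume f: "f \<in> carrier (poly_ring n)"
  then have "- f \<in> carrier (poly_ring n)"
    by (simp add: carrier_poly_ring in_keys_iff)
  then show "\<exists>g \<in> carrier (poly_ring n). g \<oplus>\<^bsub>poly_ring n\<^esub> f = \<zero>\<^bsub>poly_ring n\<^esub>"
    by (intro bexI[of _ "- f"]) auto
qed (auto simp: carrier_add carrier_mult algebra_simps, auto simp: carrier_poly_ring)

lemma poly_ring_ring: "ring (poly_ring n :: 'k::field mpoly ring)"
  using poly_ring_cring by (rule cring.axioms)

lemma monom_mult: "monom a * monom b = monom (a + b)"
  by (simp add: monom_def mult_single)

lemma keys_monom [simp]: "Poly_Mapping.keys (monom m) = {m}"
  by (simp add: monom_def)

lemma monom_carrier: "monom m \<in> carrier (poly_ring n) \<longleftrightarrow> Poly_Mapping.keys m \<subseteq> {1..n}"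
  by (simp add: carrier_poly_ring)

lemma monomials_carrier: "monomials n \<subseteq> carrier (poly_ring n)"
  by (auto simp: monomials_def monom_carrier)

lemma poly_ring_a_inv:
  assumes "f \<in> carrier (poly_ring n)"
  shows "a_inv (poly_ring n) f = - (f :: 'k::field mpoly)"
proof -
  interpret cring "poly_ring n :: 'k mpoly ring" by (rule poly_ring_cring)
  have "- f \<in> carrier (poly_ring n)"
    using assms by (simp add: carrier_poly_ring in_keys_iff)
  then show ?thesis using minus_equality[of "- f" f] assms by simp
qed

lemma poly_ring_idealI:
  fixes I :: "'k::field mpoly set"
  assumes sub: "I \<subseteq> carrier (poly_ring n)" and z: "0 \<in> I"
    and add: "\<And>f g. f \<in> I \<Longrightarrow> g \<in> I \<Longrightarrow> f + g \<in> I"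
    and mul: "\<And>f g. f \<in> I \<Longrightarrow> g \<in> carrier (poly_ring n) \<Longrightarrow> g * f \<in> I"
  shows "ideal I (poly_ring n)"
proof (rule idealI[OF poly_ring_ring])
  interpret cring "poly_ring n :: 'k mpoly ring" by (rule poly_ring_cring)
  have ne: "I \<noteq> {}" using z by blast
  show "subgroup I (add_monoid (poly_ring n))"
  proof (rule add.subgroupI)
    fix f assume f: "f \<in> I"
    have "- 1 \<in> carrier (poly_ring n)" by (simp add: carrier_poly_ring in_keys_iff lookup_one)
    from mul[OF f this] show "\<ominus>\<^bsub>poly_ring n\<^esub> f \<in> I"
      using f sub by (simp add: poly_ring_a_inv subset_iff)
  qed (use sub add ne in auto)
qed (use mul in \<open>auto simp: mult.commute\<close>)

lemma poly_ring_idealD: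
  fixes I :: "'k::field mpoly set"
  assumes "ideal I (poly_ring n)"
  shows "I \<subseteq> carrier (poly_ring n)" "0 \<in> I"
    "\<And>f g. f \<in> I \<Longrightarrow> g \<in> I \<Longrightarrow> f + g \<in> I"
    "\<And>f g. f \<in> I \<Longrightarrow> g \<in> carrier (poly_ring n) \<Longrightarrow> g * f \<in> I"
proof -
  interpret ideal I "poly_ring n" by fact
  show "I \<subseteq> carrier (poly_ring n)" using Icarr by blast
  show "0 \<in> I" using additive_subgroup.zero_closed[OF ideal.axioms(1)[OF assms]] by simp
  show "\<And>f g. f \<in> I \<Longrightarrow> g \<in> I \<Longrightarrow> f + g \<in> I"
    using additive_subgroup.a_closed[OF ideal.axioms(1)[OF assms]] by simp
  show "\<And>f g. f \<in> I \<Longrightarrow> g \<in> carrier (poly_ring n) \<Longrightarrow> g * f \<in> I" using I_l_closed by simp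
qed

lemma ideal_monomwise:
  fixes I :: "'k::field mpoly set"
  assumes I: "ideal I (poly_ring n)" and m: "\<forall>m \<in> Poly_Mapping.keys f. monom m \<in> I"
  shows "f \<in> I"
proof -
  have s: "Poly_Mapping.single m c \<in> I" if "monom m \<in> I" for m c
  proof -
    have "Poly_Mapping.single 0 c \<in> carrier (poly_ring n)" by (simp add: carrier_poly_ring)
    from poly_ring_idealD(4)[OF I that this] show ?thesis
      by (simp add: monom_def mult_single)
  qed
  have fin: "finite A \<Longrightarrow> A \<subseteq> Poly_Mapping.keys f \<Longrightarrow>
      (\<Sum>m\<in>A. Poly_Mapping.single m (Poly_Mapping.lookup f m)) \<in> I" for A
    by (induction A rule: finite_induct)
      (use m s poly_ring_idealD(2,3)[OF I] in auto)
  have "f = (\<Sum>m\<in>Poly_Mapping.keys f. Poly_Mapping.single m (Poly_Mapping.lookup f m))"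
    by (rule poly_mapping_eqI)
      (auto simp: lookup_sum lookup_single when_def in_keys_iff)
  with fin[OF finite_keys subset_refl] show ?thesis by simp
qed

lemma monomial_ideal_ideal: "monomial_ideal n I \<Longrightarrow> ideal I (poly_ring n)"
  unfolding monomial_ideal_def
  using ring.genideal_ideal[OF poly_ring_ring] monomials_carrier by blast

lemma monomial_ideal_monomwise:
  fixes I :: "'k::field mpoly set"
  assumes "monomial_ideal n I" and "f \<in> I" and "m \<in> Poly_Mapping.keys f"
  shows "monom m \<in> I"
proof -
  interpret cring "poly_ring n :: 'k mpoly ring" by (rule poly_ring_cring)
  obtain M where M: "M \<subseteq> monomials n" and I: "I = genideal (poly_ring n) M"
    using assms(1) by (auto simp: monomial_ideal_def)
  note idl = monomial_ideal_ideal[OF assms(1)]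
  let ?T = "{f :: 'k mpoly. f \<in> carrier (poly_ring n) \<and>
      (\<forall>m \<in> Poly_Mapping.keys f. monom m \<in> I)}"
  have "ideal ?T (poly_ring n)"
  proof (rule poly_ring_idealI)
    fix f g :: "'k mpoly" assume "f \<in> ?T" "g \<in> ?T"
    then show "f + g \<in> ?T" using Poly_Mapping.keys_add[of f g] carrier_add[of f n g] by blast
  next
    fix f g :: "'k mpoly" assume f: "f \<in> ?T" and g: "g \<in> carrier (poly_ring n)"
    have "monom m \<in> I" if m: "m \<in> Poly_Mapping.keys (g * f)" for m
    proof -
      obtain a b where ab: "m = a + b" "a \<in> Poly_Mapping.keys g" "b \<in> Poly_Mapping.keys f"
        using keys_mult[of g f] m by blast
      have "monom a \<in> carrier (poly_ring n)" using ab g by (simp add: carrier_poly_ring)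
      moreover have "monom b \<in> I" using ab f by blast
      ultimately have "monom a * monom b \<in> I" using poly_ring_idealD(4)[OF idl] by blast
      then show ?thesis by (simp add: ab monom_mult)
    qed
    with f g show "g * f \<in> ?T" by (simp add: carrier_mult)
  qed (auto simp: carrier_poly_ring)
  moreover have "M \<subseteq> ?T"
  proof
    fix v assume v: "v \<in> M"
    then have "v \<in> I" using I genideal_self M monomials_carrier by blast
    with v M monomials_carrier show "v \<in> ?T" by (fastforce simp: monomials_def)
  qed
  ultimately have "I \<subseteq> ?T" unfolding I by (rule genideal_minimal)
  with assms show ?thesis by blast
qed

lemma monomial_ideal_Inter:
  fixes C :: "'k::field mpoly set set"
  assumes "C \<noteq> {}" and "\<And>I. I \<in> C \<Longrightarrow> monomial_ideal n I"
  shows "monomial_ideal n (\<Inter>C)"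
proof -
  interpret cring "poly_ring n :: 'k mpoly ring" by (rule poly_ring_cring)
  let ?M = "{v \<in> monomials n. v \<in> \<Inter>C}"
  have idC: "ideal (\<Inter>C) (poly_ring n)"
    using assms monomial_ideal_ideal by (intro i_Intersect) auto
  have sub: "?M \<subseteq> carrier (poly_ring n)" using monomials_carrier by blast
  have "\<Inter>C = genideal (poly_ring n) ?M"
  proof (rule equalityI)
    show "genideal (poly_ring n) ?M \<subseteq> \<Inter>C" by (rule genideal_minimal[OF idC]) blast
    show "\<Inter>C \<subseteq> genideal (poly_ring n) ?M"
    proof
      fix f assume f: "f \<in> \<Inter>C"
      have "monom m \<in> ?M" if m: "m \<in> Poly_Mapping.keys f" for m
      proof -
        have "monom m \<in> \<Inter>C" using f m assms(2) monomial_ideal_monomwise by blast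
        moreover have "Poly_Mapping.keys m \<subseteq> {1..n}"
          using f m poly_ring_idealD(1)[OF idC] carrier_poly_ring by blast
        ultimately show ?thesis by (auto simp: monomials_def)
      qed
      then show "f \<in> genideal (poly_ring n) ?M"
        using ideal_monomwise[OF genideal_ideal[OF sub]] genideal_self[OF sub] by blast
    qed
  qed
  then show ?thesis
    unfolding monomial_ideal_def by (intro exI[of _ ?M] conjI) (blast, assumption)
qed

text \<open>If \<open>t\<close> works in the defining condition then so does \<open>\<nu>\<^sub>i(v)\<close>, uniformly in the ideal.\<close>

lemma strong_Borel_type_max:
  fixes I :: "'k::field mpoly set"
  assumes "strong_Borel_type n I" "monom m \<in> I" "1 \<le> j" "j < i" "i \<le> n"
  shows "monom (Poly_Mapping.single j (Poly_Mapping.lookup m i)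
                + (m - Poly_Mapping.single i (Poly_Mapping.lookup m i))) \<in> I"
    (is "monom (Poly_Mapping.single j ?e + ?d) \<in> I")
proof -
  obtain t where t: "t \<le> ?e" "monom (Poly_Mapping.single j t + ?d) \<in> I"
    using assms unfolding strong_Borel_type_def by blast
  have "ideal I (poly_ring n)"
    using assms(1) monomial_ideal_ideal by (auto simp: strong_Borel_type_def)
  moreover have "monom (Poly_Mapping.single j (?e - t)) \<in> (carrier (poly_ring n) :: 'k mpoly set)"
    using assms by (simp add: monom_carrier)
  ultimately have "monom (Poly_Mapping.single j (?e - t)) * monom (Poly_Mapping.single j t + ?d) \<in> I"
    using poly_ring_idealD(4) t(2) by blast
  moreover have "Poly_Mapping.single j (?e - t) + (Poly_Mapping.single j t + ?d) = Poly_Mapping.single j ?e + ?d"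
    using t(1) by (simp add: single_add[symmetric] add.assoc[symmetric])
  ultimately show ?thesis by (simp add: monom_mult)
qed

lemma strong_Borel_type_Inter:
  fixes C :: "'k::field mpoly set set"
  assumes "C \<noteq> {}" and "\<And>I. I \<in> C \<Longrightarrow> strong_Borel_type n I"
  shows "strong_Borel_type n (\<Inter>C)"
  unfolding strong_Borel_type_def
proof (intro conjI allI impI)
  show "monomial_ideal n (\<Inter>C)"
    using assms by (intro monomial_ideal_Inter) (auto simp: strong_Borel_type_def)
  fix m i j assume "monom m \<in> \<Inter>C" and "1 \<le> j \<and> j < i \<and> i \<le> n"
  then show "\<exists>t \<le> Poly_Mapping.lookup m i. monom (Poly_Mapping.single j t
          + (m - Poly_Mapping.single i (Poly_Mapping.lookup m i))) \<in> \<Inter>C"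
    using assms(2) strong_Borel_type_max by (intro exI[of _ "Poly_Mapping.lookup m i"]) blast
qed

lemma strong_Borel_type_carrier:
  "strong_Borel_type n (carrier (poly_ring n) :: 'k::field mpoly set)"
  unfolding strong_Borel_type_def
proof (intro conjI allI impI)
  interpret cring "poly_ring n :: 'k mpoly ring" by (rule poly_ring_cring)
  have one: "(1 :: 'k mpoly) = monom 0" by (simp add: monom_def)
  have "(1 :: 'k mpoly) \<in> genideal (poly_ring n) {1}"
    using genideal_self'[of 1] one_closed by simp
  then have "genideal (poly_ring n) {1 :: 'k mpoly} = carrier (poly_ring n)"
    using ideal.one_imp_carrier[OF genideal_ideal[of "{1}"]] one_closed by simp
  moreover have "{1 :: 'k mpoly} \<subseteq> monomials n" unfolding one by (auto simp: monomials_def)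
  ultimately show "monomial_ideal n (carrier (poly_ring n) :: 'k mpoly set)"
    unfolding monomial_ideal_def by blast
  fix m i j
  assume m: "(monom m :: 'k mpoly) \<in> carrier (poly_ring n)" and "1 \<le> j \<and> j < i \<and> i \<le> n"
  have "Poly_Mapping.keys (m - Poly_Mapping.single i (Poly_Mapping.lookup m i)) \<subseteq> {1..n}"
    using m by (auto simp: monom_carrier in_keys_iff lookup_minus subset_iff)
  then show "\<exists>t \<le> Poly_Mapping.lookup m i. monom (Poly_Mapping.single j t
          + (m - Poly_Mapping.single i (Poly_Mapping.lookup m i)))
            \<in> (carrier (poly_ring n) :: 'k mpoly set)"
    by (intro exI[of _ 0]) (simp add: monom_carrier)
qed

lemma SBT_is_least:
  fixes u :: "'k::field mpoly"
  assumes "u \<in> monomials n"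
  shows "strong_Borel_type n (SBT n u)" and "u \<in> SBT n u"
    and "\<And>J. strong_Borel_type n J \<Longrightarrow> u \<in> J \<Longrightarrow> SBT n u \<subseteq> J"
proof -
  let ?C = "{I. strong_Borel_type n I \<and> u \<in> I}"
  have ne: "?C \<noteq> {}" using strong_Borel_type_carrier assms monomials_carrier by blast
  have P: "strong_Borel_type n (\<Inter>?C)" using strong_Borel_type_Inter[OF ne] by blast
  have "SBT n u = \<Inter>?C"
    unfolding SBT_def by (rule Least_equality) (use P in auto)
  then show "strong_Borel_type n (SBT n u)" and "u \<in> SBT n u"
    and "\<And>J. strong_Borel_type n J \<Longrightarrow> u \<in> J \<Longrightarrow> SBT n u \<subseteq> J"
    using P by auto
qed

end

theory Submission
  imports Defs
begin

text \<open>
  The product of the ideals is generated by the monomials \<open>\<Prod>\<^sub>q x\<^bsub>j q\<^esub>\<^bsup>\<alpha> q\<^esup>\<close> with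
  \<open>1 \<le> j q \<le> i q\<close>.  Replacing \<open>x\<^sub>k\<close> by \<open>x\<^sub>l\<close> for some \<open>l < k\<close> turns such a generator into another
  one, so the product is of strong Borel type.  Conversely, each generator is reached from \<open>u\<close> by
  moving the factors one at a time, from \<open>q = 1\<close> up to \<open>q = r\<close>: as \<open>i\<close> is increasing, when the
  \<open>q\<close>-th factor is moved no other factor is a power of \<open>x\<^bsub>i q\<^esub>\<close>.
\<close>

subsection \<open>Products of generated ideals\<close>

text \<open>This is the colon ideal of \<open>J\<close> by \<open>X\<close>. Because it is an ideal,
  the condition that all products with \<open>X\<close> lie in \<open>J\<close> need only be checked
  on generators.\<close>

lemma (in cring) ideal_colon:
  assumes "ideal J R" "X \<subseteq> carrier R"
  shows "ideal {y \<in> carrier R. \<forall>x\<in>X. x \<otimes> y \<in> J} R" (is "ideal ?C R")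
proof (rule idealI[OF ring_axioms])
  interpret J: ideal J R by fact
  have X: "\<And>x. x \<in> X \<Longrightarrow> x \<in> carrier R" using assms(2) by blast
  show "subgroup ?C (add_monoid R)"
  proof (rule add.subgroupI)
    have "\<zero> \<in> ?C" using X by (auto simp: r_null)
    then show "?C \<noteq> {}" by blast
  next
    fix a assume "a \<in> ?C"
    then show "\<ominus> a \<in> ?C" using X by (auto simp: r_minus)
  next
    fix a b assume "a \<in> ?C" "b \<in> ?C"
    then show "a \<oplus> b \<in> ?C" using X by (auto simp: r_distr)
  qed auto
next
  interpret J: ideal J R by fact
  fix a x assume a: "a \<in> ?C" and x: "x \<in> carrier R"
  have "y \<otimes> (x \<otimes> a) \<in> J" if "y \<in> X" for y
  proof -
    have "y \<in> carrier R" using that assms(2) by blast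
    then have "y \<otimes> (x \<otimes> a) = x \<otimes> (y \<otimes> a)" using a x by (simp add: m_lcomm)
    then show ?thesis using a x that by (simp add: J.I_l_closed)
  qed
  then show "x \<otimes> a \<in> ?C" using a x by auto
  then show "a \<otimes> x \<in> ?C" using a x by (simp add: m_comm)
qed

text \<open>For the inclusion from left to right, products of generators are extended to products of
  arbitrary elements one factor at a time, each time by minimality of a generated ideal inside a
  colon ideal.\<close>

lemma (in cring) ideal_prod_genideal:
  assumes A: "A \<subseteq> carrier R" and B: "B \<subseteq> carrier R"
  shows "(Idl A) \<cdot> (Idl B) = Idl (A <#> B)"
proof (rule equalityI)
  have AB: "A <#> B \<subseteq> carrier R" using A B by (rule set_mult_closed)
  note J = genideal_ideal[OF AB]
  interpret J: ideal "Idl (A <#> B)" R by (rule J)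
  have A': "Idl A \<subseteq> carrier R"
    using ideal.Icarr[OF genideal_ideal[OF A]] by blast
  have gens: "a \<otimes> b \<in> Idl (A <#> B)" if "a \<in> A" "b \<in> B" for a b
    using that genideal_self[OF AB] by (auto simp: set_mult_def)
  \<comment> \<open>First the left factor is extended from \<open>A\<close> to \<open>Idl A\<close>
    with the right factor still in \<open>B\<close>; fact \<open>2\<close> then extends the right
    factor, taking the colon by all of \<open>Idl A\<close>.\<close>
  have 1: "Idl A \<subseteq> {y \<in> carrier R. \<forall>b\<in>B. b \<otimes> y \<in> Idl (A <#> B)}"
  proof (rule genideal_minimal[OF ideal_colon[OF J B]])
    show "A \<subseteq> {y \<in> carrier R. \<forall>b\<in>B. b \<otimes> y \<in> Idl (A <#> B)}"
      using gens A B by (auto simp: subset_iff m_comm)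
  qed
  have 2: "Idl B \<subseteq> {y \<in> carrier R. \<forall>x\<in>Idl A. x \<otimes> y \<in> Idl (A <#> B)}"
  proof (rule genideal_minimal[OF ideal_colon[OF J A']])
    show "B \<subseteq> {y \<in> carrier R. \<forall>x\<in>Idl A. x \<otimes> y \<in> Idl (A <#> B)}"
      using 1 B by (auto simp: subset_iff m_comm)
  qed
  show "(Idl A) \<cdot> (Idl B) \<subseteq> Idl (A <#> B)"
  proof
    fix s assume "s \<in> (Idl A) \<cdot> (Idl B)"
    then show "s \<in> Idl (A <#> B)"
      by (induct s rule: ideal_prod.induct) (use 2 in auto)
  qed
  show "Idl (A <#> B) \<subseteq> (Idl A) \<cdot> (Idl B)"
  proof (rule genideal_minimal)
    show "ideal ((Idl A) \<cdot> (Idl B)) R"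
      using A B by (intro ideal_prod_is_ideal genideal_ideal)
    show "A <#> B \<subseteq> (Idl A) \<cdot> (Idl B)"
      using genideal_self[OF A] genideal_self[OF B] by (auto simp: set_mult_def intro: ideal_prod.prod)
  qed
qed

text \<open>Induction on \<open>Q\<close> with the binary case. A generator of the product is a
  choice of one generator per factor. The choices are taken extensional so that those on
  \<open>insert q Q\<close> correspond to pairs of an element of \<open>A q\<close> and a choice on
  \<open>Q\<close>.\<close>

lemma (in cring) finprod_genideal:
  assumes "finite Q" and "\<And>q. q \<in> Q \<Longrightarrow> A q \<subseteq> carrier R"
  shows "(\<Otimes>\<^bsub>ideals_set R\<^esub>q\<in>Q. Idl (A q)) = Idl ((\<lambda>g. \<Otimes>q\<in>Q. g q) ` (\<Pi>\<^sub>E q\<in>Q. A q))"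
  using assms
proof (induction Q rule: finite_induct)
  case empty
  interpret M: comm_monoid "ideals_set R" by (rule ideals_set_is_comm_monoid)
  \<comment> \<open>The only choice function on the empty set gives the empty product, so the
    right-hand side is the ideal generated by one, which is the whole ring and hence the unit of
    \<open>ideals_set R\<close>.\<close>
  show ?case by (simp add: genideal_one) (simp add: ideals_set_def)
next
  case (insert q Q)
  interpret M: comm_monoid "ideals_set R" by (rule ideals_set_is_comm_monoid)
  let ?P = "\<lambda>Q. (\<lambda>g. \<Otimes>q\<in>Q. g q) ` (\<Pi>\<^sub>E q\<in>Q. A q)"
  have carr: "A p \<subseteq> carrier R" if "p \<in> insert q Q" for p using insert.prems that by blast
  have P: "?P Q \<subseteq> carrier R"
  proof
    fix x assume "x \<in> ?P Q"
    then obtain g where g: "g \<in> (\<Pi>\<^sub>E q\<in>Q. A q)" and x: "x = (\<Otimes>q\<in>Q. g q)" by blast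
    have "g \<in> Q \<rightarrow> carrier R" using g carr by (fastforce simp: PiE_iff)
    then show "x \<in> carrier R" unfolding x by (rule finprod_closed)
  qed
  have upd: "(\<Otimes>p\<in>insert q Q. (g(q := a)) p) = a \<otimes> (\<Otimes>p\<in>Q. g p)"
    if "a \<in> A q" "g \<in> (\<Pi>\<^sub>E q\<in>Q. A q)" for a g
  proof -
    have g: "g \<in> Q \<rightarrow> carrier R" using that carr by (fastforce simp: PiE_iff)
    have "finprod R (g(q := a)) Q = finprod R g Q"
      by (rule finprod_cong') (use g insert.hyps in auto)
    moreover have "g(q := a) \<in> Q \<rightarrow> carrier R" using g insert.hyps by auto
    moreover have "a \<in> carrier R" using that carr by blast
    ultimately show ?thesis using insert.hyps by (simp del: fun_upd_apply add: fun_upd_same)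
  qed
  have "?P (insert q Q) = (\<lambda>(a, g). a \<otimes> (\<Otimes>p\<in>Q. g p)) ` (A q \<times> (\<Pi>\<^sub>E q\<in>Q. A q))"
    unfolding PiE_insert_eq image_image
    by (rule image_cong[OF refl]) (auto simp only: mem_Times_iff split_beta upd)
  also have "\<dots> = A q <#> ?P Q"
    unfolding set_mult_def by auto
  finally have PI: "?P (insert q Q) = A q <#> ?P Q" .
  have "(\<Otimes>\<^bsub>ideals_set R\<^esub>q\<in>insert q Q. Idl (A q))
      = (Idl (A q)) \<otimes>\<^bsub>ideals_set R\<^esub> (\<Otimes>\<^bsub>ideals_set R\<^esub>q\<in>Q. Idl (A q))"
    using insert.hyps carr
    by (intro M.finprod_insert) (auto simp: ideals_set_def intro!: genideal_ideal)
  also have "\<dots> = (Idl (A q)) \<cdot> (Idl (?P Q))"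
    using insert.IH carr by (simp add: ideals_set_def)
  also have "\<dots> = Idl (A q <#> ?P Q)"
    using carr P by (intro ideal_prod_genideal) auto
  finally show ?case unfolding PI .
qed

text \<open>Passes from the product of the ring structure to the type-class product, where monomials
  are easily multiplied. Both products are 1 over an infinite index set.\<close>

lemma finprod_poly_ring:
  fixes f :: "'a \<Rightarrow> 'k::field mpoly"
  assumes "f \<in> A \<rightarrow> carrier (poly_ring n)"
  shows "finprod (poly_ring n) f A = (\<Prod>a\<in>A. f a)"
proof -
  interpret cring "poly_ring n :: 'k mpoly ring" by (rule poly_ring_cring)
  show ?thesis
  proof (cases "finite A")
    case True
    then show ?thesis using assms by (induction A rule: finite_induct) auto
  next
    case False
    then show ?thesis by (simp add: finprod_infinite)
  qed
qed

subsection \<open>Monomials\<close>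

lemma var_power: "var k ^ a = monom (Poly_Mapping.single k a)"
proof (induction a)
  case 0
  then show ?case by (simp add: monom_def)
next
  case (Suc a)
  then show ?case by (simp add: var_def monom_mult single_add[symmetric])
qed

lemma prod_monom: "(\<Prod>q\<in>Q. monom (f q)) = monom (\<Sum>q\<in>Q. f q)"
proof (induction Q rule: infinite_finite_induct)
  case (insert q Q)
  then show ?case by (simp add: monom_mult)
qed (simp_all add: monom_def)

text \<open>Membership of a monomial is divisibility by a generator: the polynomials all of whose
  monomials are divisible by some generator form an ideal \<open>?T\<close> containing the
  generators.\<close>

lemma monom_in_genideal_iff:
  fixes G :: "(nat \<Rightarrow>\<^sub>0 nat) set"
  assumes G: "\<And>g. g \<in> G \<Longrightarrow> Poly_Mapping.keys g \<subseteq> {1..n}"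
  shows "(monom m :: 'k::field mpoly) \<in> genideal (poly_ring n) (monom ` G) \<longleftrightarrow>
    Poly_Mapping.keys m \<subseteq> {1..n} \<and> (\<exists>g\<in>G. \<exists>w. m = g + w)" (is "?l \<longleftrightarrow> ?r")
proof
  interpret cring "poly_ring n :: 'k mpoly ring" by (rule poly_ring_cring)
  have sub: "(monom ` G :: 'k mpoly set) \<subseteq> carrier (poly_ring n)"
    using G by (auto simp: monom_carrier)
  let ?T = "{f :: 'k mpoly. f \<in> carrier (poly_ring n) \<and>
      (\<forall>m \<in> Poly_Mapping.keys f. \<exists>g\<in>G. \<exists>w. m = g + w)}"
  have "ideal ?T (poly_ring n)"
  proof (rule poly_ring_idealI)
    fix f g :: "'k mpoly" assume "f \<in> ?T" "g \<in> ?T"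
    then show "f + g \<in> ?T" using Poly_Mapping.keys_add[of f g] carrier_add[of f n g] by blast
  next
    fix f g :: "'k mpoly" assume f: "f \<in> ?T" and g: "g \<in> carrier (poly_ring n)"
    have "\<exists>h\<in>G. \<exists>w. m = h + w" if m: "m \<in> Poly_Mapping.keys (g * f)" for m
    proof -
      obtain a b where ab: "m = a + b" "b \<in> Poly_Mapping.keys f"
        using keys_mult[of g f] m by blast
      then obtain h w where "h \<in> G" "b = h + w" using f by blast
      with ab have "m = h + (a + w)" by (simp add: ac_simps)
      with \<open>h \<in> G\<close> show ?thesis by blast
    qed
    with f g show "g * f \<in> ?T" by (simp add: carrier_mult)
  qed (auto simp: carrier_poly_ring)
  moreover have "monom ` G \<subseteq> ?T"
    using G by (auto simp: monom_carrier) (metis add_0_right)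
  ultimately have "genideal (poly_ring n) (monom ` G) \<subseteq> ?T" by (rule genideal_minimal)
  then show ?r if ?l using subsetD[OF _ that] by (fastforce simp: monom_carrier)
  assume ?r
  then obtain g w where g: "g \<in> G" and w: "m = w + g" and m: "Poly_Mapping.keys m \<subseteq> {1..n}"
    by (auto simp: add.commute)
  have "(monom w :: 'k mpoly) \<in> carrier (poly_ring n)"
    using m by (simp add: w monom_carrier keys_add_nat)
  moreover have "(monom g :: 'k mpoly) \<in> genideal (poly_ring n) (monom ` G)"
    using genideal_self[OF sub] g by blast
  ultimately show ?l
    using poly_ring_idealD(4)[OF genideal_ideal[OF sub]] by (metis monom_mult w)
qed

subsection \<open>Substituting one variable for another in a monomial\<close>

text \<open>On exponent vectors, this is the substitution of x_j for x_i, and it is the case t =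
  nu_i(v) of the strong Borel condition. The subtraction removes exactly the exponent of x_i, so
  truncation never interferes and the map is additive.\<close>

definition replace_var :: "nat \<Rightarrow> nat \<Rightarrow> (nat \<Rightarrow>\<^sub>0 nat) \<Rightarrow> (nat \<Rightarrow>\<^sub>0 nat)" where
  "replace_var i j m = Poly_Mapping.single j (Poly_Mapping.lookup m i)
     + (m - Poly_Mapping.single i (Poly_Mapping.lookup m i))"

lemma replace_var_0 [simp]: "replace_var i j 0 = 0"
  by (simp add: replace_var_def)

lemma replace_var_add: "replace_var i j (a + b) = replace_var i j a + replace_var i j b"
  by (rule poly_mapping_eqI)
    (auto simp: replace_var_def lookup_add lookup_minus lookup_single when_def)

lemma replace_var_sum: "replace_var i j (\<Sum>q\<in>Q. f q) = (\<Sum>q\<in>Q. replace_var i j (f q))"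
  by (induction Q rule: infinite_finite_induct) (simp_all add: replace_var_add)

lemma replace_var_single:
  "replace_var i j (Poly_Mapping.single k a) = Poly_Mapping.single (if k = i then j else k) a"
  by (rule poly_mapping_eqI)
    (auto simp: replace_var_def lookup_add lookup_minus lookup_single when_def)

lemma replace_var_idem: "i \<notin> Poly_Mapping.keys m \<Longrightarrow> replace_var i j m = m"
  by (simp add: replace_var_def in_keys_iff)

lemma keys_replace_var: "Poly_Mapping.keys (replace_var i j m) \<subseteq> insert j (Poly_Mapping.keys m)"
  by (auto simp: replace_var_def in_keys_iff lookup_add lookup_minus lookup_single when_def
      split: if_splits)

section \<open>Strong Borel type and substitution of variables\<close>

text \<open>Reduces the condition to generators: since \<open>replace_var\<close> is additive, if g
  divides m then the image of g divides the image of m.\<close>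

lemma strong_Borel_type_genideal:
  fixes G :: "(nat \<Rightarrow>\<^sub>0 nat) set"
  assumes G: "\<And>g. g \<in> G \<Longrightarrow> Poly_Mapping.keys g \<subseteq> {1..n}"
    and closed: "\<And>g i j. g \<in> G \<Longrightarrow> 1 \<le> j \<Longrightarrow> j < i \<Longrightarrow> i \<le> n \<Longrightarrow> replace_var i j g \<in> G"
  shows "strong_Borel_type n (genideal (poly_ring n) (monom ` G) :: 'k::field mpoly set)"
  unfolding strong_Borel_type_def
proof (intro conjI allI impI)
  show "monomial_ideal n (genideal (poly_ring n) (monom ` G) :: 'k mpoly set)"
    unfolding monomial_ideal_def
    by (intro exI[of _ "monom ` G"] conjI refl) (use G in \<open>auto simp: monomials_def\<close>)
  fix m i j
  assume "(monom m :: 'k mpoly) \<in> genideal (poly_ring n) (monom ` G)"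
    and ij: "1 \<le> j \<and> j < i \<and> i \<le> n"
  then obtain g w where m: "Poly_Mapping.keys m \<subseteq> {1..n}" and g: "g \<in> G" and w: "m = g + w"
    using monom_in_genideal_iff[of G n m, OF G] by blast
  have "Poly_Mapping.keys (replace_var i j m) \<subseteq> {1..n}"
    using m ij keys_replace_var[of i j m] by fastforce
  moreover have "replace_var i j g \<in> G" using closed g ij by blast
  ultimately have "(monom (replace_var i j m) :: 'k mpoly) \<in> genideal (poly_ring n) (monom ` G)"
    using monom_in_genideal_iff[of G n "replace_var i j m", OF G]
    unfolding w replace_var_add by blast
  \<comment> \<open>The witness for t is the full exponent \<open>lookup m i\<close>.\<close>
  then show "\<exists>t \<le> Poly_Mapping.lookup m i. monom (Poly_Mapping.single j t
          + (m - Poly_Mapping.single i (Poly_Mapping.lookup m i)))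
            \<in> (genideal (poly_ring n) (monom ` G) :: 'k mpoly set)"
    unfolding replace_var_def by blast
qed

text \<open>Since x_i does not occur in the cofactor \<open>m\<close>, the substitution moves
  exactly the power with exponent \<open>a\<close> and leaves \<open>m\<close> fixed. The case j = i
  is included because a factor may also stay where it is.\<close>

lemma strong_Borel_type_replace:
  fixes I :: "'k::field mpoly set"
  assumes "strong_Borel_type n I" and "monom (Poly_Mapping.single i a + m) \<in> I"
    and "1 \<le> j" "j \<le> i" "i \<le> n" and "i \<notin> Poly_Mapping.keys m"
  shows "monom (Poly_Mapping.single j a + m) \<in> I"
proof (cases "j = i")
  case False
  then have "monom (replace_var i j (Poly_Mapping.single i a + m)) \<in> I"
    unfolding replace_var_def using assms by (intro strong_Borel_type_max) auto
  then show ?thesis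
    using assms(6) by (simp add: replace_var_add replace_var_single replace_var_idem)
qed (use assms in simp)

lemma strong_Borel_type_replace_all:
  fixes I :: "'k::field mpoly set" and i j \<alpha> :: "nat \<Rightarrow> nat"
  assumes I: "strong_Borel_type n I"
    and u: "monom (\<Sum>q\<in>{1..r}. Poly_Mapping.single (i q) (\<alpha> q)) \<in> I"
    and i: "\<And>q. q \<in> {1..r} \<Longrightarrow> i q \<le> n" and mono: "strict_mono_on {1..r} i"
    and j: "\<And>q. q \<in> {1..r} \<Longrightarrow> j q \<in> {1..i q}"
  shows "monom (\<Sum>q\<in>{1..r}. Poly_Mapping.single (j q) (\<alpha> q)) \<in> I"
proof -
  \<comment> \<open>Intermediate choice: the first \<open>s\<close> factors are already moved to
    their targets, the others still sit at their original variables.\<close>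
  let ?g = "\<lambda>s q. if q \<le> s then j q else i q"
  have "monom (\<Sum>q\<in>{1..r}. Poly_Mapping.single (?g s q) (\<alpha> q)) \<in> I" if "s \<le> r" for s
    using that
  proof (induction s)
    case 0
    have "(\<Sum>q\<in>{1..r}. Poly_Mapping.single (?g 0 q) (\<alpha> q))
        = (\<Sum>q\<in>{1..r}. Poly_Mapping.single (i q) (\<alpha> q))"
      by (rule sum.cong) auto
    with u show ?case by simp
  next
    case (Suc s)
    let ?p = "Suc s"
    let ?rest = "\<lambda>s. \<Sum>q\<in>{1..r} - {?p}. Poly_Mapping.single (?g s q) (\<alpha> q)"
    have p: "?p \<in> {1..r}" using Suc.prems by simp
    have split: "(\<Sum>q\<in>{1..r}. Poly_Mapping.single (?g t q) (\<alpha> q))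
        = Poly_Mapping.single (?g t ?p) (\<alpha> ?p) + ?rest t" for t
      by (rule sum.remove[OF _ p]) simp
    \<comment> \<open>An already moved factor has index at most i q, which is below
      \<open>i ?p\<close> since q < \<open>?p\<close>; a factor not yet moved has index i q, which
      is above \<open>i ?p\<close> since q > \<open>?p\<close>.\<close>
    have "?g s q \<noteq> i ?p" if q: "q \<in> {1..r} - {?p}" for q
    proof (cases "q \<le> s")
      case True
      then have "i q < i ?p" using q p by (intro strict_mono_onD[OF mono]) auto
      then show ?thesis using j[of q] q True by auto
    next
      case False
      then have "i ?p < i q" using q p by (intro strict_mono_onD[OF mono]) auto
      then show ?thesis using False by auto
    qed
    then have keys: "i ?p \<notin> Poly_Mapping.keys (?rest s)"
      using keys_sum[of "\<lambda>q. Poly_Mapping.single (?g s q) (\<alpha> q)" "{1..r} - {?p}"]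
      by (fastforce simp del: atLeastAtMost_iff split del: if_split split: if_split_asm)
    have "monom (Poly_Mapping.single (i ?p) (\<alpha> ?p) + ?rest s) \<in> I"
      using Suc unfolding split by simp
    moreover have "1 \<le> j ?p" "j ?p \<le> i ?p" using j[OF p] by simp_all
    ultimately have "monom (Poly_Mapping.single (j ?p) (\<alpha> ?p) + ?rest s) \<in> I"
      using strong_Borel_type_replace[OF I _ _ _ i[OF p] keys] by blast
    moreover have "?rest s = ?rest ?p"
      by (rule sum.cong) auto
    ultimately show ?case unfolding split by simp
  qed
  from this[of r] have "monom (\<Sum>q\<in>{1..r}. Poly_Mapping.single (?g r q) (\<alpha> q)) \<in> I" by simp
  moreover have "(\<Sum>q\<in>{1..r}. Poly_Mapping.single (?g r q) (\<alpha> q))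
      = (\<Sum>q\<in>{1..r}. Poly_Mapping.single (j q) (\<alpha> q))"
    by (rule sum.cong) auto
  ultimately show ?thesis by simp
qed

section \<open>The product formula\<close>

text \<open>Choosing a generator in each factor amounts to choosing an index \<open>j q\<close>.
  Here \<open>j\<close> need not be extensional, because its values outside \<open>Q\<close> do not
  enter the sum.\<close>

lemma finprod_genideal_var_power:
  fixes i \<alpha> :: "nat \<Rightarrow> nat"
  assumes "finite Q" and i: "\<And>q. q \<in> Q \<Longrightarrow> i q \<le> n"
  shows "(\<Otimes>\<^bsub>ideals_set (poly_ring n)\<^esub> q \<in> Q.
       genideal (poly_ring n) ((\<lambda>k. var k ^ \<alpha> q) ` {1..i q}))
    = (genideal (poly_ring n)
        (monom ` (\<lambda>j. \<Sum>q\<in>Q. Poly_Mapping.single (j q) (\<alpha> q)) ` (\<Pi> q\<in>Q. {1..i q}))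
       :: 'k::field mpoly set)"
proof -
  interpret cring "poly_ring n :: 'k mpoly ring" by (rule poly_ring_cring)
  let ?A = "\<lambda>q. (\<lambda>k. var k ^ \<alpha> q) ` {1..i q} :: 'k mpoly set"
  have A: "?A q \<subseteq> carrier (poly_ring n)" if "q \<in> Q" for q
    using i[OF that] by (auto simp: var_power monom_carrier)
  have fp: "finprod (poly_ring n) g Q = (\<Prod>q\<in>Q. g q)" if "g \<in> (\<Pi>\<^sub>E q\<in>Q. ?A q)" for g
  proof (rule finprod_poly_ring)
    show "g \<in> Q \<rightarrow> carrier (poly_ring n)"
    proof
      fix q assume "q \<in> Q"
      then show "g q \<in> carrier (poly_ring n)" using that A[of q] by (auto dest: PiE_mem)
    qed
  qed
  have "finprod (poly_ring n) g Q \<in> monom ` (\<lambda>j. \<Sum>q\<in>Q. Poly_Mapping.single (j q) (\<alpha> q)) ` (\<Pi> q\<in>Q. {1..i q})"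
    if g: "g \<in> (\<Pi>\<^sub>E q\<in>Q. ?A q)" for g
  proof -
    have "\<forall>q\<in>Q. \<exists>k\<in>{1..i q}. g q = var k ^ \<alpha> q" using g by (auto dest!: PiE_mem)
    then obtain j where j: "\<And>q. q \<in> Q \<Longrightarrow> j q \<in> {1..i q} \<and> g q = var (j q) ^ \<alpha> q" by metis
    have "finprod (poly_ring n) g Q = (\<Prod>q\<in>Q. monom (Poly_Mapping.single (j q) (\<alpha> q)))"
      unfolding fp[OF g] by (rule prod.cong) (use j in \<open>auto simp: var_power\<close>)
    also have "\<dots> = monom (\<Sum>q\<in>Q. Poly_Mapping.single (j q) (\<alpha> q))" by (rule prod_monom)
    finally show ?thesis using j by blast
  qed
  moreover have "monom (\<Sum>q\<in>Q. Poly_Mapping.single (j q) (\<alpha> q))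
      \<in> (\<lambda>g. finprod (poly_ring n) g Q) ` (\<Pi>\<^sub>E q\<in>Q. ?A q)"
    if j: "j \<in> (\<Pi> q\<in>Q. {1..i q})" for j
  proof -
    \<comment> \<open>Restriction to \<open>Q\<close> makes the choice of powers extensional, as
      membership in the \<open>PiE\<close> set demands.\<close>
    let ?g = "restrict (\<lambda>q. var (j q) ^ \<alpha> q) Q :: _ \<Rightarrow> 'k mpoly"
    have g: "?g \<in> (\<Pi>\<^sub>E q\<in>Q. ?A q)" using j by auto
    have "finprod (poly_ring n) ?g Q = (\<Prod>q\<in>Q. monom (Poly_Mapping.single (j q) (\<alpha> q)))"
      unfolding fp[OF g] by (rule prod.cong) (auto simp: var_power)
    also have "\<dots> = monom (\<Sum>q\<in>Q. Poly_Mapping.single (j q) (\<alpha> q))" by (rule prod_monom)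
    finally show ?thesis using g by (rule image_eqI[OF sym])
  qed
  ultimately have "(\<lambda>g. finprod (poly_ring n) g Q) ` (\<Pi>\<^sub>E q\<in>Q. ?A q)
      = monom ` (\<lambda>j. \<Sum>q\<in>Q. Poly_Mapping.single (j q) (\<alpha> q)) ` (\<Pi> q\<in>Q. {1..i q})"
    by blast
  then show ?thesis using finprod_genideal[OF \<open>finite Q\<close>, of ?A] A by simp
qed

theorem lemma1p4:
  fixes n r :: nat and i \<alpha> :: "nat \<Rightarrow> nat" and u :: "'k::field mpoly"
  assumes "infinite (UNIV :: 'k set)"
    and "n \<ge> 2" and "r \<ge> 1"
    and "\<And>q. q \<in> {1..r} \<Longrightarrow> 1 \<le> i q \<and> i q \<le> n"
    and "strict_mono_on {1..r} i"
    and "\<And>q. q \<in> {1..r} \<Longrightarrow> \<alpha> q > 0"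
    and "u = (\<Prod>q\<in>{1..r}. var (i q) ^ \<alpha> q)"
  shows "SBT n u =
    (\<Otimes>\<^bsub>ideals_set (poly_ring n)\<^esub> q \<in> {1..r}.
       genideal (poly_ring n) ((\<lambda>k. var k ^ \<alpha> q) ` {1..i q}))"
proof -
  interpret cring "poly_ring n :: 'k mpoly ring" by (rule poly_ring_cring)
  let ?e = "\<lambda>j. \<Sum>q\<in>{1..r}. Poly_Mapping.single (j q) (\<alpha> q)"
  define G where "G = ?e ` (\<Pi> q\<in>{1..r}. {1..i q})"
  let ?P = "genideal (poly_ring n) (monom ` G) :: 'k mpoly set"
  have G: "Poly_Mapping.keys g \<subseteq> {1..n}" if "g \<in> G" for g
  proof -
    obtain j where j: "j \<in> (\<Pi> q\<in>{1..r}. {1..i q})" and g: "g = ?e j"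
      using \<open>g \<in> G\<close> by (auto simp: G_def)
    have "j q \<in> {1..n}" if "q \<in> {1..r}" for q using Pi_mem[OF j that] assms(4)[OF that] by auto
    then show ?thesis unfolding g by (intro order_trans[OF keys_sum]) auto
  qed
  have sub: "monom ` G \<subseteq> (carrier (poly_ring n) :: 'k mpoly set)"
    using G by (auto simp: monom_carrier)
  have u: "u = monom (?e i)" unfolding assms(7) var_power by (rule prod_monom)
  have iG: "?e i \<in> G" unfolding G_def using assms(4) by (intro imageI) auto
  have "replace_var k l g \<in> G" if "g \<in> G" "1 \<le> l" "l < k" for g k l
  proof -
    obtain j where j: "j \<in> (\<Pi> q\<in>{1..r}. {1..i q})" and g: "g = ?e j"
      using \<open>g \<in> G\<close> by (auto simp: G_def)
    \<comment> \<open>Substituting x_l for x_k only changes the choice function: every factor at k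
      moves to l. Since l < k, the new index still lies within the bound \<open>i q\<close>.\<close>
    have "replace_var k l g = ?e (\<lambda>q. if j q = k then l else j q)"
      by (simp only: g replace_var_sum replace_var_single)
    moreover have "(\<lambda>q. if j q = k then l else j q) \<in> (\<Pi> q\<in>{1..r}. {1..i q})"
    proof
      fix q assume "q \<in> {1..r}"
      from Pi_mem[OF j this] show "(if j q = k then l else j q) \<in> {1..i q}" using that by auto
    qed
    ultimately show ?thesis unfolding G_def by (rule image_eqI)
  qed
  then have SBT_P: "strong_Borel_type n ?P"
    using G by (intro strong_Borel_type_genideal) auto
  have uP: "u \<in> ?P" unfolding u using genideal_self[OF sub] iG by blast
  have "u \<in> monomials n" unfolding u monomials_def using G[OF iG] by blast
  note least = SBT_is_least[OF this]
  have mem: "monom (?e i) \<in> SBT n u" using least(2) unfolding u .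
  \<comment> \<open>By minimality of the generated ideal it suffices to reach each generator from
    \<open>u\<close>, which is the choice \<open>j = i\<close>.\<close>
  have "?P \<subseteq> SBT n u"
  proof (rule genideal_minimal)
    show "ideal (SBT n u) (poly_ring n)"
      using least(1) monomial_ideal_ideal unfolding strong_Borel_type_def by blast
    show "monom ` G \<subseteq> SBT n u"
      unfolding G_def
    proof (intro subsetI, elim imageE, hypsubst)
      fix j assume j: "j \<in> (\<Pi> q\<in>{1..r}. {1..i q})"
      show "monom (?e j) \<in> SBT n u"
        by (rule strong_Borel_type_replace_all[OF least(1) mem _ assms(5)])
          (use assms(4) Pi_mem[OF j] in blast)+
    qed
  qed
  moreover have "SBT n u \<subseteq> ?P" using least(3)[OF SBT_P uP] .
  ultimately have "SBT n u = ?P" by blast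
  also have "?P = (\<Otimes>\<^bsub>ideals_set (poly_ring n)\<^esub> q \<in> {1..r}.
       genideal (poly_ring n) ((\<lambda>k. var k ^ \<alpha> q) ` {1..i q}))"
    unfolding G_def by (rule finprod_genideal_var_power[symmetric]) (use assms(4) in auto)
  finally show ?thesis .
qed

end
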